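(* There is a polynomial-time algorithm that, for every instance of BMST, outputs a feasible leader's choice $X$ with $c(X\cup Y)\le(|V|-1)\cdot\mathrm{OPT}$, where $Y$ is the follower's response to $X$ and $\mathrm{OPT}$ is the optimum value.
   Context: An instance of BMST consists of a finite connected undirected graph $G=(V,E)$, possibly with parallel edges, whose edge set is partitioned into disjoint sets $E^\ell$ (leader's edges) and $E^f$ (follower's edges), cost functions $c,d\colon E\to\mathbb{R}_{\ge 0}$, and a fixed linear order $e_1,\dots,e_m$ of $E^f$ nondecreasing in $d$. For $Z\subseteq E$, $c(Z)=\sum_{e\in Z}c(e)$. A leader's choice is a cycle-free $X\subseteq E^\ell$, feasible if $(V,X\cup E^f)$ is connected. The follower's response $Y$ to $X$: start with $Y=\emptyset$, for $i=1,\dots,m$ add $e_i$ if $X\cup Y\cup\{e_i\}$ is cycle-free (for feasible $X$, $X\cup Y$ is a spanning tree minimizing $d(Y)$). The leader seeks a feasible $X$ minimizing $c(X\cup Y)$; this minimum is $\mathrm{OPT}$. *)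

theory Defs
  imports Complex_Main "HOL-Computational_Algebra.Polynomial"
begin

section \<open>The bilevel minimum spanning tree problem\<close>

text \<open>Edges are abstract objects with a set of two end vertices, so parallel edges are possible
  and loops are not. The follower's edge set is given by the list \<open>ford\<close>, which also
  carries the fixed linear order.\<close>

record ('v, 'e) bmst =
  verts :: "'v set"
  lead :: "'e set"
  ford :: "'e list"
  ends :: "'e \<Rightarrow> 'v set"
  ccost :: "'e \<Rightarrow> real"
  dcost :: "'e \<Rightarrow> real"

definition foll :: "('v, 'e) bmst \<Rightarrow> 'e set" where
  "foll I = set (ford I)"

definition edges :: "('v, 'e) bmst \<Rightarrow> 'e set" where
  "edges I = lead I \<union> foll I"

definition adj :: "('v, 'e) bmst \<Rightarrow> 'e set \<Rightarrow> 'v rel" where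
  "adj I F = {(u, v). \<exists>e\<in>F. ends I e = {u, v}}"

definition connects :: "('v, 'e) bmst \<Rightarrow> 'e set \<Rightarrow> bool" where
  "connects I F \<longleftrightarrow> (\<forall>u\<in>verts I. \<forall>v\<in>verts I. (u, v) \<in> (adj I F)\<^sup>*)"

text \<open>A cycle is a cyclic sequence of distinct vertices and distinct edges; two parallel edges form
  a cycle of length 2.\<close>

definition is_cycle :: "('v, 'e) bmst \<Rightarrow> 'v list \<Rightarrow> 'e list \<Rightarrow> bool" where
  "is_cycle I ws es \<longleftrightarrow>
     2 \<le> length es \<and> length ws = length es \<and> distinct ws \<and> distinct es \<and>
     (\<forall>i<length es. ends I (es ! i) = {ws ! i, ws ! (Suc i mod length es)})"

definition cycle_free :: "('v, 'e) bmst \<Rightarrow> 'e set \<Rightarrow> bool" where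
  "cycle_free I F \<longleftrightarrow> \<not> (\<exists>ws es. set es \<subseteq> F \<and> is_cycle I ws es)"

definition bmst_instance :: "('v, 'e) bmst \<Rightarrow> bool" where
  "bmst_instance I \<longleftrightarrow>
     finite (verts I) \<and> verts I \<noteq> {} \<and> finite (lead I) \<and> lead I \<inter> foll I = {} \<and>
     (\<forall>e\<in>edges I. ends I e \<subseteq> verts I \<and> card (ends I e) = 2) \<and>
     connects I (edges I) \<and>
     (\<forall>e\<in>edges I. 0 \<le> ccost I e \<and> 0 \<le> dcost I e) \<and>
     distinct (ford I) \<and> sorted (map (dcost I) (ford I))"

definition leader_choice :: "('v, 'e) bmst \<Rightarrow> 'e set \<Rightarrow> bool" where
  "leader_choice I X \<longleftrightarrow> X \<subseteq> lead I \<and> cycle_free I X"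

definition feasible :: "('v, 'e) bmst \<Rightarrow> 'e set \<Rightarrow> bool" where
  "feasible I X \<longleftrightarrow> leader_choice I X \<and> connects I (X \<union> foll I)"

definition response :: "('v, 'e) bmst \<Rightarrow> 'e set \<Rightarrow> 'e set" where
  "response I X =
     fold (\<lambda>e Y. if cycle_free I (X \<union> Y \<union> {e}) then Y \<union> {e} else Y) (ford I) {}"

definition leader_cost :: "('v, 'e) bmst \<Rightarrow> 'e set \<Rightarrow> real" where
  "leader_cost I X = (\<Sum>e\<in>X \<union> response I X. ccost I e)"

definition OPT :: "('v, 'e) bmst \<Rightarrow> real" where
  "OPT I = Min {leader_cost I X |X. feasible I X}"


section \<open>Machine model\<close>

text \<open>
  Since the costs are real numbers, algorithms are programs of an additive real random access
  machine: natural numbers and reals are kept in separate memories, each consisting of arrays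
  indexed by natural numbers (the first argument of a memory is the name of the array, of which a
  program can mention only finitely many). Arrays are accessed at computed indices. The only
  operations are addition, (truncated) subtraction and comparison, there is no conversion between
  reals and naturals, and the only real constant is 0. Each assignment and each test takes one time
  unit; as expressions are part of the program text, charging for their size would change the
  running time by a constant factor depending on the program only. Without multiplication the bit
  length of a number grows by at most a constant per step, so that a polynomial bound on the number
  of steps gives a polynomial-time algorithm in the bit model for rational inputs as well.
\<close>

record memory =
  nmem :: "nat \<Rightarrow> nat \<Rightarrow> nat"
  rmem :: "nat \<Rightarrow> nat \<Rightarrow> real"

datatype nexp =
    NConst nat
  | NCell nat nexp
  | NAdd nexp nexp
  | NSub nexp nexp

datatype rexp =
    RZero
  | RCell nat nexp
  | RAdd rexp rexp
  | RSub rexp rexp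

datatype bexp =
    NLess nexp nexp
  | RLess rexp rexp
  | BNot bexp
  | BAnd bexp bexp

fun nval :: "nexp \<Rightarrow> memory \<Rightarrow> nat" where
  "nval (NConst k) s = k"
| "nval (NCell a i) s = nmem s a (nval i s)"
| "nval (NAdd x y) s = nval x s + nval y s"
| "nval (NSub x y) s = nval x s - nval y s"

fun rval :: "rexp \<Rightarrow> memory \<Rightarrow> real" where
  "rval RZero s = 0"
| "rval (RCell a i) s = rmem s a (nval i s)"
| "rval (RAdd x y) s = rval x s + rval y s"
| "rval (RSub x y) s = rval x s - rval y s"

fun bval :: "bexp \<Rightarrow> memory \<Rightarrow> bool" where
  "bval (NLess x y) s \<longleftrightarrow> nval x s < nval y s"
| "bval (RLess x y) s \<longleftrightarrow> rval x s < rval y s"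
| "bval (BNot b) s \<longleftrightarrow> \<not> bval b s"
| "bval (BAnd b b') s \<longleftrightarrow> bval b s \<and> bval b' s"

definition nstore :: "nat \<Rightarrow> nat \<Rightarrow> nat \<Rightarrow> memory \<Rightarrow> memory" where
  "nstore a i x s = s\<lparr>nmem := (nmem s)(a := (nmem s a)(i := x))\<rparr>"

definition rstore :: "nat \<Rightarrow> nat \<Rightarrow> real \<Rightarrow> memory \<Rightarrow> memory" where
  "rstore a i x s = s\<lparr>rmem := (rmem s)(a := (rmem s a)(i := x))\<rparr>"

datatype prog =
    Skip
  | NAssign nat nexp nexp
  | RAssign nat nexp rexp
  | Seq prog prog
  | Cond bexp prog prog
  | Loop bexp prog

text \<open>\<open>exec P s t s'\<close>: started in memory \<open>s\<close>, the program \<open>P\<close> halts in memory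
  \<open>s'\<close> after \<open>t\<close> time units.\<close>

inductive exec :: "prog \<Rightarrow> memory \<Rightarrow> nat \<Rightarrow> memory \<Rightarrow> bool" where
  Skip: "exec Skip s 1 s"
| NAssign: "exec (NAssign a i x) s 1 (nstore a (nval i s) (nval x s) s)"
| RAssign: "exec (RAssign a i x) s 1 (rstore a (nval i s) (rval x s) s)"
| Seq: "exec P s t s' \<Longrightarrow> exec Q s' t' s'' \<Longrightarrow> exec (Seq P Q) s (t + t') s''"
| CondT: "bval b s \<Longrightarrow> exec P s t s' \<Longrightarrow> exec (Cond b P Q) s (t + 1) s'"
| CondF: "\<not> bval b s \<Longrightarrow> exec Q s t s' \<Longrightarrow> exec (Cond b P Q) s (t + 1) s'"
| LoopF: "\<not> bval b s \<Longrightarrow> exec (Loop b P) s 1 s"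
| LoopT: "bval b s \<Longrightarrow> exec P s t s' \<Longrightarrow> exec (Loop b P) s' t' s'' \<Longrightarrow>
           exec (Loop b P) s (t + t' + 1) s''"

lemma exec_deterministic:
  assumes "exec P s t s'" and "exec P s u s''"
  shows "u = t \<and> s'' = s'"
  using assms
proof (induction arbitrary: u s'' rule: exec.induct)
  case (Seq P s t s' Q t' s2)
  from Seq.prems show ?case by (cases rule: exec.cases) (use Seq.IH in blast)+
next
  case (CondT b s P t s' Q)
  from CondT.prems show ?case by (cases rule: exec.cases) (use CondT in blast)+
next
  case (CondF b s Q t s' P)
  from CondF.prems show ?case by (cases rule: exec.cases) (use CondF in blast)+
next
  case (LoopT b s P t s' t' s2)
  from LoopT.prems show ?case by (cases rule: exec.cases) (use LoopT in blast)+
qed (auto elim: exec.cases)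


section \<open>Input and output\<close>

text \<open>
  Vertices and leader's edges are numbered by arbitrary enumerations \<open>vs\<close> and \<open>ls\<close>; the
  follower's edges are numbered after the leader's edges, in the given order.
  Input: array 0 holds the numbers of vertices, leader's edges and follower's edges; arrays 1 and 2
  hold, for each edge, the numbers of its two end vertices (in any order); the real arrays 0
  and 1 hold the costs \<open>c\<close> and \<open>d\<close>; all other cells are 0.
  Output: the nonzero entries of array 3 mark the chosen leader's edges.
\<close>

definition encodes :: "('v, 'e) bmst \<Rightarrow> 'v list \<Rightarrow> 'e list \<Rightarrow> memory \<Rightarrow> bool" where
  "encodes I vs ls s \<longleftrightarrow>
     distinct vs \<and> set vs = verts I \<and> distinct ls \<and> set ls = lead I \<and>
     (let es = ls @ ford I in
       nmem s 0 = (\<lambda>i. if i = 0 then length vs else if i = 1 then length ls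
                       else if i = 2 then length (ford I) else 0) \<and>
       (\<forall>i<length es. nmem s 1 i < length vs \<and> nmem s 2 i < length vs \<and>
          ends I (es ! i) = {vs ! nmem s 1 i, vs ! nmem s 2 i}) \<and>
       (\<forall>i\<ge>length es. nmem s 1 i = 0 \<and> nmem s 2 i = 0) \<and>
       (\<forall>a>2. \<forall>i. nmem s a i = 0) \<and>
       rmem s 0 = (\<lambda>i. if i < length es then ccost I (es ! i) else 0) \<and>
       rmem s 1 = (\<lambda>i. if i < length es then dcost I (es ! i) else 0) \<and>
       (\<forall>a>1. \<forall>i. rmem s a i = 0))"

definition decode :: "'e list \<Rightarrow> memory \<Rightarrow> 'e set" where
  "decode ls s = {ls ! i |i. i < length ls \<and> nmem s 3 i \<noteq> 0}"

text \<open>The input size is the number of vertices and edges. Instances are finite, so labelling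
  vertices and edges by natural numbers is no restriction; it allows a single program and a single
  polynomial to be chosen before the instance.\<close>

definition polytime_algorithm ::
  "((nat, nat) bmst \<Rightarrow> nat set \<Rightarrow> bool) \<Rightarrow> prog \<Rightarrow> bool" where
  "polytime_algorithm Q P \<longleftrightarrow>
     (\<exists>p :: nat poly. \<forall>I vs ls s. bmst_instance I \<longrightarrow> encodes I vs ls s \<longrightarrow>
        (\<exists>t s'. exec P s t s' \<and> t \<le> poly p (card (verts I) + card (edges I)) \<and>
                Q I (decode ls s')))"

end

theory Submission imports Defs begin

text \<open>The algorithm solves the bottleneck version exactly. For a threshold \<open>B\<close>, the
  leader takes a spanning forest of all its edges of cost at most \<open>B\<close>. An edge enters the
  response iff its ends are not joined by the leader's choice and the earlier follower's edges, so
  this choice excludes every follower's edge that some choice of edges of cost at most \<open>B\<close>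
  excludes. Hence, for the largest cost \<open>B\<close> in an optimal tree, no edge costing more than
  \<open>B\<close> is used, and the smallest edge cost that works as a threshold is at most \<open>OPT\<close>.
  The resulting tree has \<open>|V| - 1\<close> edges, each costing at most \<open>OPT\<close>.\<close>

section \<open>Connectivity and forests\<close>

text \<open>For the total cost a larger choice can hurt, since a leader's edge may cost more than
  the follower's edge it displaces. For the largest cost it cannot, as long as the added edges
  respect the threshold: adding edges only displaces more of the follower's. This monotonicity
  replaces any search over choices. Comparing the largest edge of an optimal tree with
  \<open>OPT\<close> rests on nonnegative costs: one summand is at most the sum. Whether an edge
  enters the response depends only on components, so the machine maintains component labels and
  neither looks for cycles nor computes a response. Feasibility has to be tested along with the
  costs, and an instance without edges, which offers no edge cost to try, is served by threshold
  0.\<close>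

lemma adj_mono: "F \<subseteq> G \<Longrightarrow> (adj I F)\<^sup>* \<subseteq> (adj I G)\<^sup>*"
  by (rule rtrancl_mono) (auto simp: adj_def)

lemma adj_rtrancl_sym: "(u, v) \<in> (adj I F)\<^sup>* \<longleftrightarrow> (v, u) \<in> (adj I F)\<^sup>*"
proof -
  have "sym (adj I F)"
    by (auto simp: sym_def adj_def insert_commute)
  then show ?thesis
    by (meson sym_rtrancl symD)
qed

lemma adj_insert:
  assumes "ends I e = {a, b}"
  shows "adj I (insert e F) = insert (a, b) (insert (b, a) (adj I F))"
  using assms by (auto simp: adj_def doubleton_eq_iff)

text \<open>A walk through the new edge can be shortened until it crosses that edge once, in one of
  two directions.\<close>

lemma adj_rtrancl_insert:
  assumes "ends I e = {a, b}"
  shows "(u, v) \<in> (adj I (insert e F))\<^sup>* \<longleftrightarrow> (u, v) \<in> (adj I F)\<^sup>* \<or>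
    (u, a) \<in> (adj I F)\<^sup>* \<and> (b, v) \<in> (adj I F)\<^sup>* \<or> (u, b) \<in> (adj I F)\<^sup>* \<and> (a, v) \<in> (adj I F)\<^sup>*"
  unfolding adj_insert[OF assms] rtrancl_insert
  by (blast intro: rtrancl_trans)

lemma adj_rtrancl_insert_linked:
  assumes "ends I e = {a, b}" and "(a, b) \<in> (adj I F)\<^sup>*"
  shows "(adj I (insert e F))\<^sup>* = (adj I F)\<^sup>*"
proof -
  have "(b, a) \<in> (adj I F)\<^sup>*"
    using assms(2) adj_rtrancl_sym by metis
  then have "(u, v) \<in> (adj I (insert e F))\<^sup>* \<longleftrightarrow> (u, v) \<in> (adj I F)\<^sup>*" for u v
    unfolding adj_rtrancl_insert[OF assms(1)] using assms(2) by (meson rtrancl_trans)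
  then show ?thesis by auto
qed

text \<open>This allows an edge set to be replaced by a spanning forest of it inside any union:
  further edges only see components.\<close>

lemma adj_rtrancl_Un_cong:
  assumes "(adj I F)\<^sup>* = (adj I G)\<^sup>*"
  shows "(adj I (F \<union> H))\<^sup>* = (adj I (G \<union> H))\<^sup>*"
proof -
  have "adj I (A \<union> B) = adj I A \<union> adj I B" for A B
    by (auto simp: adj_def)
  then show ?thesis
    using assms by (metis rtrancl_Un_rtrancl)
qed

section \<open>Cycles and linked ends\<close>

lemma simple_path:
  assumes "(a, b) \<in> (adj I F)\<^sup>*"
  shows "\<exists>p. p \<noteq> [] \<and> p ! 0 = a \<and> last p = b \<and> distinct p \<and>
    (\<forall>i. Suc i < length p \<longrightarrow> (p ! i, p ! Suc i) \<in> adj I F)"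
  using assms
proof (induction rule: rtrancl_induct)
  case base
  show ?case by (rule exI[of _ "[a]"]) simp
next
  case (step y z)
  then obtain p where p: "p \<noteq> []" "p ! 0 = a" "last p = y" "distinct p"
    "\<And>i. Suc i < length p \<Longrightarrow> (p ! i, p ! Suc i) \<in> adj I F" by blast
  show ?case
  proof (cases "z \<in> set p")
    case True
    then obtain k where k: "k < length p" "p ! k = z" by (auto simp: in_set_conv_nth)
    \<comment> \<open>A vertex met before is reached by cutting the path there, which keeps the path
      simple.\<close>
    then have "last (take (Suc k) p) = z"
      by (simp add: take_Suc_conv_app_nth)
    then show ?thesis
      using p k by (intro exI[of _ "take (Suc k) p"]) auto
  next
    case False
    have "((p @ [z]) ! i, (p @ [z]) ! Suc i) \<in> adj I F" if "Suc i < length (p @ [z])" for i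
    proof (cases "Suc i < length p")
      case False
      then have "i = length p - 1" "Suc i = length p" using that p(1) by auto
      then show ?thesis
        using p(1,3) step.hyps(2) by (simp add: nth_append last_conv_nth)
    qed (use p(5) in \<open>simp add: nth_append\<close>)
    then show ?thesis
      using p False by (intro exI[of _ "p @ [z]"]) (auto simp: nth_append)
  qed
qed

lemma cycle_free_mono: "cycle_free I G \<Longrightarrow> F \<subseteq> G \<Longrightarrow> cycle_free I F"
  unfolding cycle_free_def by blast

lemma cycle_free_empty: "cycle_free I {}"
  by (auto simp: cycle_free_def is_cycle_def)

text \<open>A simple path from \<open>a\<close> to \<open>b\<close> in \<open>F\<close> is closed up
  by \<open>e\<close>. If the path is a single edge parallel to \<open>e\<close>, this is a cycle of
  length 2.\<close>

lemma cycle_if_linked: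
  assumes e: "ends I e = {a, b}" "a \<noteq> b" "e \<notin> F" and ab: "(a, b) \<in> (adj I F)\<^sup>*"
  shows "\<not> cycle_free I (insert e F)"
proof -
  obtain p where p: "p \<noteq> []" "p ! 0 = a" "last p = b" "distinct p"
    "\<And>i. Suc i < length p \<Longrightarrow> (p ! i, p ! Suc i) \<in> adj I F"
    using simple_path[OF ab] by blast
  then obtain f where f: "\<And>i. Suc i < length p \<Longrightarrow> f i \<in> F \<and> ends I (f i) = {p ! i, p ! Suc i}"
    unfolding adj_def by simp metis
  define es where "es = map f [0..<length p - 1] @ [e]"
  have len: "length es = length p" using p(1) by (simp add: es_def)
  have last: "p ! (length p - 1) = b" using p(1,3) by (simp add: last_conv_nth)
  have "length p \<noteq> 1" using last p(2) e(2) by auto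
  with p(1) have "2 \<le> length p" by (cases p) (auto simp: neq_Nil_conv Suc_le_eq)
  \<comment> \<open>Equal edges have equal pairs of ends, and on a path without repeated vertices a
    pair of consecutive vertices determines its position.\<close>
  have "inj_on f {0..<length p - 1}"
  proof (rule inj_onI)
    fix i j assume ij: "i \<in> {0..<length p - 1}" "j \<in> {0..<length p - 1}" "f i = f j"
    then have "{p ! i, p ! Suc i} = {p ! j, p ! Suc j}" using f[of i] f[of j] by auto
    then show "i = j"
      using ij p(4) by (auto simp: doubleton_eq_iff nth_eq_iff_index_eq)
  qed
  moreover have "e \<notin> f ` {0..<length p - 1}" using f e(3) by auto
  ultimately have dist: "distinct es" by (auto simp: es_def distinct_map)
  have "set es \<subseteq> insert e F" using f by (auto simp: es_def)
  moreover have "ends I (es ! i) = {p ! i, p ! (Suc i mod length p)}" if "i < length p" for i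
  proof (cases "Suc i < length p")
    case True
    then have "i < length p - 1" by simp
    then show ?thesis using f[OF True] True by (simp add: es_def nth_append)
  next
    case False
    then have "i = length p - 1" "Suc i = length p" using that by auto
    then show ?thesis using e(1) last p(2) by (auto simp: es_def nth_append)
  qed
  ultimately show ?thesis
    unfolding cycle_free_def is_cycle_def using len dist p(4) \<open>2 \<le> length p\<close> by metis
qed

text \<open>The cycle cannot lie in \<open>F\<close>, so it uses \<open>e\<close>, and only once
  because its edges are distinct; going round the rest of it joins the two ends.\<close>

lemma linked_if_cycle:
  assumes e: "ends I e = {a, b}" and F: "cycle_free I F" and c: "\<not> cycle_free I (insert e F)"
  shows "(a, b) \<in> (adj I F)\<^sup>*"
proof -
  obtain ws es where sub: "set es \<subseteq> insert e F" and cyc: "is_cycle I ws es"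
    using c unfolding cycle_free_def by blast
  define l where "l = length es"
  have l: "2 \<le> l" "length ws = l" "distinct es"
    "\<And>i. i < l \<Longrightarrow> ends I (es ! i) = {ws ! i, ws ! (Suc i mod l)}"
    using cyc by (auto simp: is_cycle_def l_def)
  have "\<not> set es \<subseteq> F" using F cyc unfolding cycle_free_def by blast
  with sub have "e \<in> set es" by blast
  then obtain k where k: "k < l" "es ! k = e" by (auto simp: in_set_conv_nth l_def)
  have adj: "(ws ! j, ws ! (Suc j mod l)) \<in> adj I F" if "j < l" "j \<noteq> k" for j
  proof -
    have "es ! j \<noteq> e" using that k l(3) by (metis l_def nth_eq_iff_index_eq)
    moreover have "es ! j \<in> set es" using that l_def by simp
    ultimately have "es ! j \<in> F" using sub by auto
    then show ?thesis using l(4)[OF that(1)] by (auto simp: adj_def)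
  qed
  \<comment> \<open>The index \<open>d\<close> counts steps after crossing \<open>e\<close>; as
    \<open>d < l\<close>, none of them uses position \<open>k\<close> again, and
    \<open>d = l - 1\<close> arrives back at \<open>ws ! k\<close>.\<close>
  have "(ws ! (Suc k mod l), ws ! ((Suc k + d) mod l)) \<in> (adj I F)\<^sup>*" if "d < l" for d
    using that
  proof (induction d)
    case (Suc d)
    define j where "j = (Suc k + d) mod l"
    have "j < l" using l(1) by (simp add: j_def)
    have "j \<noteq> k"
    proof
      assume "j = k"
      then have "(k + Suc d) mod l = (k + 0) mod l" using k by (simp add: j_def)
      then have "Suc d mod l = 0 mod l" by (simp add: mod_eq_dvd_iff_nat)
      then show False using Suc.prems by simp
    qed
    have "(ws ! j, ws ! (Suc j mod l)) \<in> adj I F" using adj \<open>j < l\<close> \<open>j \<noteq> k\<close> by blast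
    moreover have "Suc j mod l = (Suc k + Suc d) mod l" by (simp add: j_def mod_Suc_eq)
    ultimately show ?case using Suc by (simp add: j_def)
  qed simp_all
  from this[of "l - 1"] have "(ws ! (Suc k mod l), ws ! k) \<in> (adj I F)\<^sup>*"
    using l(1) k(1) by (simp add: Suc_diff_le add.commute)
  moreover have "{a, b} = {ws ! k, ws ! (Suc k mod l)}" using l(4)[OF k(1)] k(2) e by simp
  ultimately show ?thesis
    using adj_rtrancl_sym[of a b I F] by (auto simp: doubleton_eq_iff)
qed

lemma cycle_free_insert_iff:
  assumes "ends I e = {a, b}" "a \<noteq> b" "e \<notin> F" "cycle_free I F"
  shows "cycle_free I (insert e F) \<longleftrightarrow> (a, b) \<notin> (adj I F)\<^sup>*"
  using cycle_if_linked[OF assms(1-3)] linked_if_cycle[OF assms(1,4)] by blast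

section \<open>Spanning forests and component labels\<close>

text \<open>Spanning refers to each component of \<open>F\<close>, which need not be
  connected.\<close>

definition spanning_forest :: "('v, 'e) bmst \<Rightarrow> 'e set \<Rightarrow> 'e set \<Rightarrow> bool" where
  "spanning_forest I X F \<longleftrightarrow> X \<subseteq> F \<and> cycle_free I X \<and> (adj I X)\<^sup>* = (adj I F)\<^sup>*"

text \<open>The greedy step common to the follower's response and to the leader's phase of the
  program. The test may be made in \<open>F\<close> because \<open>X\<close> has the same
  components.\<close>

lemma spanning_forest_insert:
  assumes XF: "spanning_forest I X F" and e: "ends I e = {a, b}" "a \<noteq> b" "e \<notin> F"
  shows "spanning_forest I (if (a, b) \<in> (adj I F)\<^sup>* then X else insert e X) (insert e F)"
proof (cases "(a, b) \<in> (adj I F)\<^sup>*")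
  case True
  then show ?thesis
    using XF adj_rtrancl_insert_linked[OF e(1) True] by (auto simp: spanning_forest_def)
next
  case False
  have "(adj I (insert e X))\<^sup>* = (adj I (insert e F))\<^sup>*"
    using adj_rtrancl_Un_cong[of I X F "{e}"] XF by (simp add: spanning_forest_def)
  moreover have "cycle_free I (insert e X)"
    using XF e False cycle_free_insert_iff[OF e(1,2)] by (auto simp: spanning_forest_def)
  ultimately show ?thesis
    using XF False by (auto simp: spanning_forest_def)
qed

text \<open>Labels belong to vertex positions, as in the program's array, and only their equality
  carries information. The notion serves both as loop invariant and for counting the components of a
  forest.\<close>

definition labels :: "('v, 'e) bmst \<Rightarrow> 'v list \<Rightarrow> 'e set \<Rightarrow> (nat \<Rightarrow> nat) \<Rightarrow> bool" where
  "labels I vs F f \<longleftrightarrow> (\<forall>u<length vs. \<forall>v<length vs.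
     f u = f v \<longleftrightarrow> (vs ! u, vs ! v) \<in> (adj I F)\<^sup>*)"

lemma labels_empty: "distinct vs \<Longrightarrow> (\<And>u. u < length vs \<Longrightarrow> f u = u) \<Longrightarrow> labels I vs {} f"
  by (auto simp: labels_def adj_def nth_eq_iff_index_eq)

text \<open>Renaming the class of \<open>b\<close> is correct even if \<open>a\<close> and
  \<open>b\<close> already share a label, so the program can merge without asking.\<close>

lemma labels_insert:
  assumes f: "labels I vs F f" and e: "ends I e = {vs ! a, vs ! b}" "a < length vs" "b < length vs"
    and g: "\<And>u. u < length vs \<Longrightarrow> g u = (if f u = f b then f a else f u)"
  shows "labels I vs (insert e F) g"
  unfolding labels_def
proof (intro allI impI)
  fix u v assume uv: "u < length vs" "v < length vs"
  have "(vs ! x, vs ! y) \<in> (adj I F)\<^sup>* \<longleftrightarrow> f x = f y" if "x < length vs" "y < length vs" for x y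
    using f that by (auto simp: labels_def)
  then show "g u = g v \<longleftrightarrow> (vs ! u, vs ! v) \<in> (adj I (insert e F))\<^sup>*"
    using uv e(2,3) by (auto simp: g adj_rtrancl_insert[OF e(1)])
qed

text \<open>Each edge of a forest joins two different classes, so every merge makes one label
  disappear.\<close>

lemma forest_labels:
  assumes "finite F" "cycle_free I F" "distinct vs"
    and "\<And>e. e \<in> F \<Longrightarrow> ends I e \<subseteq> set vs \<and> card (ends I e) = 2"
  shows "\<exists>f. labels I vs F f \<and> card (f ` {..<length vs}) + card F \<le> length vs"
  using assms
proof (induction F)
  case empty
  have "labels I vs {} id" using empty by (auto intro: labels_empty)
  then show ?case by (intro exI[of _ id]) (simp add: id_def)
next
  case (insert e F)
  have cf: "cycle_free I F" using insert.prems(1) cycle_free_mono by blast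
  then obtain f where f: "labels I vs F f" "card (f ` {..<length vs}) + card F \<le> length vs"
    using insert by blast
  obtain x y where xy: "ends I e = {x, y}" "x \<noteq> y"
    using insert.prems(3)[of e] by (auto simp: card_2_iff)
  then obtain a b where ab: "x = vs ! a" "y = vs ! b" "a < length vs" "b < length vs"
    using insert.prems(3)[of e] by (auto simp: in_set_conv_nth)
  define g where "g u = (if f u = f b then f a else f u)" for u
  have "(x, y) \<notin> (adj I F)\<^sup>*"
    using insert.prems(1) insert.hyps(2) cf cycle_free_insert_iff[OF xy] by blast
  then have ne: "f a \<noteq> f b" using f(1) ab by (auto simp: labels_def)
  have "g ` {..<length vs} \<subseteq> f ` {..<length vs} - {f b}" using ab ne by (auto simp: g_def)
  then have "card (g ` {..<length vs}) \<le> card (f ` {..<length vs} - {f b})"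
    by (intro card_mono) auto
  also have "\<dots> < card (f ` {..<length vs})" using ab by (intro card_Diff1_less) auto
  finally have "card (g ` {..<length vs}) + card (insert e F) \<le> length vs"
    using f(2) insert.hyps by simp
  moreover have "labels I vs (insert e F) g"
    using labels_insert[OF f(1) xy(1)[unfolded ab] ab(3,4)] g_def by blast
  ultimately show ?case by blast
qed

text \<open>There is a vertex, hence at least one label remains; this accounts for the summand
  1.\<close>

lemma forest_card:
  assumes "bmst_instance I" "F \<subseteq> edges I" "cycle_free I F"
  shows "card F + 1 \<le> card (verts I)"
proof -
  obtain vs where vs: "distinct vs" "set vs = verts I"
    using assms(1) finite_distinct_list[of "verts I"] by (auto simp: bmst_instance_def)
  have fin: "finite (edges I)"
    using assms(1) by (simp add: bmst_instance_def edges_def foll_def)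
  have ends: "ends I e \<subseteq> set vs \<and> card (ends I e) = 2" if "e \<in> F" for e
    using assms(1,2) that vs by (auto simp: bmst_instance_def)
  have "\<exists>f. labels I vs F f \<and> card (f ` {..<length vs}) + card F \<le> length vs"
    by (rule forest_labels[OF rev_finite_subset[OF fin assms(2)] assms(3) vs(1)]) (rule ends)
  then obtain f :: "nat \<Rightarrow> nat" where f: "card (f ` {..<length vs}) + card F \<le> length vs" by blast
  have "length vs = card (verts I)" using vs distinct_card by metis
  moreover have "vs \<noteq> []" using vs assms(1) by (auto simp: bmst_instance_def)
  then have "0 < card (f ` {..<length vs})" by (auto simp: card_gt_0_iff)
  ultimately show ?thesis using f by linarith
qed

section \<open>The follower's response and bottleneck thresholds\<close>

definition linked :: "('v, 'e) bmst \<Rightarrow> 'e set \<Rightarrow> 'e \<Rightarrow> bool" where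
  "linked I F e \<longleftrightarrow> (\<forall>u\<in>ends I e. \<forall>v\<in>ends I e. (u, v) \<in> (adj I F)\<^sup>*)"

lemma linked_iff: "ends I e = {a, b} \<Longrightarrow> linked I F e \<longleftrightarrow> (a, b) \<in> (adj I F)\<^sup>*"
  using adj_rtrancl_sym[of a b I F] by (auto simp: linked_def)

lemma linked_mono: "linked I F e \<Longrightarrow> F \<subseteq> G \<Longrightarrow> linked I G e"
  using adj_mono[of F G I] by (auto simp: linked_def)

lemma linked_cong: "(adj I F)\<^sup>* = (adj I G)\<^sup>* \<Longrightarrow> linked I F e \<longleftrightarrow> linked I G e"
  by (simp add: linked_def)

lemma linked_member: "e \<in> F \<Longrightarrow> card (ends I e) = 2 \<Longrightarrow> linked I F e"
  by (auto simp: card_2_iff linked_iff adj_def intro!: r_into_rtrancl bexI[of _ e])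

lemma linked_if_connects:
  assumes "bmst_instance I" "connects I F" "e \<in> edges I"
  shows "linked I F e"
proof -
  have "ends I e \<subseteq> verts I"
    using assms(1,3) by (auto simp: bmst_instance_def)
  then show ?thesis
    using assms(2) by (auto simp: linked_def connects_def)
qed

text \<open>The whole graph is connected, so it suffices to replace each of its edges by a walk in
  \<open>F\<close>. Feasibility thus becomes a test on edges.\<close>

lemma connects_if_linked:
  assumes "bmst_instance I" "\<And>e. e \<in> edges I \<Longrightarrow> linked I F e"
  shows "connects I F"
proof -
  have "adj I (edges I) \<subseteq> (adj I F)\<^sup>*"
    using assms(2) by (fastforce simp: adj_def linked_def)
  then have "(adj I (edges I))\<^sup>* \<subseteq> (adj I F)\<^sup>*"
    by (metis rtrancl_idemp rtrancl_mono)
  moreover have "connects I (edges I)"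
    using assms(1) by (simp add: bmst_instance_def)
  ultimately show ?thesis
    unfolding connects_def by blast
qed

lemma edge_ends:
  assumes "bmst_instance I" "e \<in> edges I"
  obtains a b where "ends I e = {a, b}" "a \<noteq> b"
proof -
  have "card (ends I e) = 2"
    using assms by (auto simp: bmst_instance_def)
  then show thesis
    using that by (auto simp: card_2_iff)
qed

text \<open>The greedy set is followed through all prefixes of the order. Accepting an edge merges
  the same components as in the prefix, and a rejected edge merges none, so each decision depends
  only on the components of \<open>X\<close> with the earlier follower's edges.\<close>

lemma response_prefix:
  assumes I: "bmst_instance I" and X: "leader_choice I X" and k: "k \<le> length (ford I)"
    and Y: "Y = fold (\<lambda>e Y. if cycle_free I (X \<union> Y \<union> {e}) then Y \<union> {e} else Y) (take k (ford I)) {}"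
  shows "spanning_forest I (X \<union> Y) (X \<union> set (take k (ford I))) \<and>
    Y = {ford I ! q |q. q < k \<and> \<not> linked I (X \<union> set (take q (ford I))) (ford I ! q)}"
  using k Y
proof (induction k arbitrary: Y)
  case 0
  then show ?case using X by (simp add: spanning_forest_def leader_choice_def)
next
  case (Suc k)
  define e where "e = ford I ! k"
  define Z where "Z = fold (\<lambda>e Y. if cycle_free I (X \<union> Y \<union> {e}) then Y \<union> {e} else Y) (take k (ford I)) {}"
  have IH: "spanning_forest I (X \<union> Z) (X \<union> set (take k (ford I)))"
    "Z = {ford I ! q |q. q < k \<and> \<not> linked I (X \<union> set (take q (ford I))) (ford I ! q)}"
    using Suc.IH[OF _ Z_def] Suc.prems(1) by auto
  have take: "take (Suc k) (ford I) = take k (ford I) @ [e]"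
    using Suc.prems(1) by (simp add: e_def take_Suc_conv_app_nth)
  then have Y: "Y = (if cycle_free I (X \<union> Z \<union> {e}) then Z \<union> {e} else Z)"
    using Suc.prems(2) by (simp add: Z_def)
  have "distinct (ford I)" using I by (simp add: bmst_instance_def)
  then have "distinct (take (Suc k) (ford I))" by (rule distinct_take)
  then have "e \<notin> set (take k (ford I))" by (simp add: take)
  have "e \<in> foll I" using Suc.prems(1) by (simp add: e_def foll_def)
  moreover have "X \<subseteq> lead I" using X by (simp add: leader_choice_def)
  ultimately have "e \<notin> X" "e \<in> edges I" using I by (auto simp: bmst_instance_def edges_def)
  then have e: "e \<notin> X \<union> set (take k (ford I))" using \<open>e \<notin> set (take k (ford I))\<close> by blast
  with IH(1) have eZ: "e \<notin> X \<union> Z" by (auto simp: spanning_forest_def)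
  obtain a b where ab: "ends I e = {a, b}" "a \<noteq> b"
    using edge_ends[OF I \<open>e \<in> edges I\<close>] .
  have iff: "cycle_free I (X \<union> Z \<union> {e}) \<longleftrightarrow> \<not> linked I (X \<union> set (take k (ford I))) e"
    using cycle_free_insert_iff[OF ab eZ] IH(1) by (simp add: linked_iff[OF ab(1)] spanning_forest_def)
  have "spanning_forest I (X \<union> Y) (X \<union> set (take (Suc k) (ford I)))"
    using spanning_forest_insert[OF IH(1) ab e] iff
    by (simp add: Y take linked_iff[OF ab(1)] split: if_splits)
  moreover have "Y = {ford I ! q |q. q < Suc k \<and> \<not> linked I (X \<union> set (take q (ford I))) (ford I ! q)}"
    unfolding Y iff unfolding IH(2) by (auto simp: e_def less_Suc_eq)
  ultimately show ?case by blast
qed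

text \<open>The second form frees the response from its recursion. Since links survive when the edge
  set grows, it shows that a larger choice can only shrink the response.\<close>

lemma
  assumes "bmst_instance I" "leader_choice I X"
  shows response_spanning_forest: "spanning_forest I (X \<union> response I X) (X \<union> foll I)"
    and response_eq: "response I X =
      {ford I ! q |q. q < length (ford I) \<and> \<not> linked I (X \<union> set (take q (ford I))) (ford I ! q)}"
  using response_prefix[OF assms order_refl, unfolded take_all[OF order_refl] foll_def[symmetric]]
    response_def[of I X] by blast+

section \<open>Bottleneck thresholds\<close>

definition cheap :: "('v, 'e) bmst \<Rightarrow> real \<Rightarrow> 'e set" where
  "cheap I B = {e \<in> lead I. ccost I e \<le> B}"

text \<open>The response only depends on the components spanned by the leader's choice. Hence a spanning
  forest of all cheap leader's edges, being best possible against expensive responses, tells whether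
  some feasible choice costs at most \<open>B\<close> per edge.\<close>

definition threshold :: "('v, 'e) bmst \<Rightarrow> real \<Rightarrow> bool" where
  "threshold I B \<longleftrightarrow>
     (\<forall>q<length (ford I). B < ccost I (ford I ! q) \<longrightarrow>
        linked I (cheap I B \<union> set (take q (ford I))) (ford I ! q)) \<and>
     (\<forall>e\<in>lead I. linked I (cheap I B \<union> foll I) e)"

text \<open>The forest has the components of the cheap edges, so the conditions in
  \<open>threshold\<close> carry over to \<open>X\<close>; follower's edges link their own
  ends.\<close>

lemma threshold_feasible:
  assumes I: "bmst_instance I" and X: "spanning_forest I X (cheap I B)" and B: "threshold I B"
  shows "feasible I X" and "\<forall>e\<in>X \<union> response I X. ccost I e \<le> B"
proof -
  have XB: "X \<subseteq> cheap I B" "(adj I X)\<^sup>* = (adj I (cheap I B))\<^sup>*"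
    using X by (auto simp: spanning_forest_def)
  have lc: "leader_choice I X"
    using X by (auto simp: leader_choice_def spanning_forest_def cheap_def)
  have link: "linked I (X \<union> F) e \<longleftrightarrow> linked I (cheap I B \<union> F) e" for F e
    by (rule linked_cong, rule adj_rtrancl_Un_cong, rule XB(2))
  have "linked I (X \<union> foll I) e" if "e \<in> edges I" for e
  proof (cases "e \<in> foll I")
    case True
    then show ?thesis
      using I that by (intro linked_member) (auto simp: bmst_instance_def)
  next
    case False
    then show ?thesis
      using B that link by (simp add: threshold_def edges_def)
  qed
  then show "feasible I X"
    using lc connects_if_linked[OF I] by (simp add: feasible_def)
  show "\<forall>e\<in>X \<union> response I X. ccost I e \<le> B"
  proof
    fix e assume "e \<in> X \<union> response I X"
    then show "ccost I e \<le> B"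
    proof
      assume "e \<in> X"
      then show ?thesis using XB(1) by (auto simp: cheap_def)
    next
      assume "e \<in> response I X"
      then obtain q where "q < length (ford I)" "e = ford I ! q"
        "\<not> linked I (cheap I B \<union> set (take q (ford I))) e"
        unfolding response_eq[OF I lc] link by blast
      then show ?thesis using B unfolding threshold_def by (meson not_le)
    qed
  qed
qed

text \<open>A choice that meets the bound lies inside \<open>cheap I B\<close>, and its links
  persist in the larger set.\<close>

lemma threshold_if_feasible:
  assumes I: "bmst_instance I" and X: "feasible I X" "\<forall>e\<in>X \<union> response I X. ccost I e \<le> B"
  shows "threshold I B"
proof -
  have lc: "leader_choice I X" using X(1) by (simp add: feasible_def)
  then have sub: "X \<subseteq> cheap I B" using X(2) by (auto simp: leader_choice_def cheap_def)
  have "linked I (cheap I B \<union> set (take q (ford I))) (ford I ! q)"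
    if "q < length (ford I)" "B < ccost I (ford I ! q)" for q
  proof -
    have "ford I ! q \<notin> response I X" using X(2) that(2) by (meson UnI2 not_le)
    then have "linked I (X \<union> set (take q (ford I))) (ford I ! q)"
      using that(1) response_eq[OF I lc] by blast
    then show ?thesis by (rule linked_mono) (use sub in blast)
  qed
  moreover have "linked I (cheap I B \<union> foll I) e" if "e \<in> lead I" for e
  proof -
    have "linked I (X \<union> foll I) e"
      using X(1) that by (intro linked_if_connects[OF I]) (auto simp: feasible_def edges_def)
    then show ?thesis by (rule linked_mono) (use sub in blast)
  qed
  ultimately show ?thesis by (simp add: threshold_def)
qed

lemma threshold_if_no_edges: "edges I = {} \<Longrightarrow> threshold I B"
  by (simp add: threshold_def edges_def foll_def)

lemma finite_edges: "bmst_instance I \<Longrightarrow> finite (edges I)"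
  by (simp add: bmst_instance_def edges_def foll_def)

text \<open>Ensures that the search over edge costs succeeds: at the largest cost nothing is too
  costly, and the whole graph is connected.\<close>

lemma ex_threshold:
  assumes "bmst_instance I" "edges I \<noteq> {}"
  shows "\<exists>e\<in>edges I. threshold I (ccost I e)"
proof -
  have "finite (edges I)" using assms(1) by (rule finite_edges)
  then obtain m where m: "m \<in> edges I" "\<And>x. x \<in> edges I \<Longrightarrow> ccost I x \<le> ccost I m"
    using assms(2) Max_in[of "ccost I ` edges I"] Max_ge[of "ccost I ` edges I"] by fastforce
  then have "cheap I (ccost I m) = lead I" by (auto simp: cheap_def edges_def)
  moreover have "linked I (edges I) e" if "e \<in> edges I" for e
    using assms(1) that by (intro linked_if_connects) (auto simp: bmst_instance_def)
  moreover have "ccost I (ford I ! q) \<le> ccost I m" if "q < length (ford I)" for q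
    using m(2) that by (simp add: edges_def foll_def)
  ultimately have "threshold I (ccost I m)"
    unfolding threshold_def by (auto simp: edges_def not_less[symmetric])
  with m(1) show ?thesis by blast
qed

section \<open>Comparison with the optimum\<close>

lemma feasible_tree:
  assumes I: "bmst_instance I" and X: "feasible I X"
  shows "cycle_free I (X \<union> response I X)" "X \<union> response I X \<subseteq> edges I"
    "connects I (X \<union> response I X)"
proof -
  have "X \<subseteq> lead I" using X by (simp add: feasible_def leader_choice_def)
  moreover have "spanning_forest I (X \<union> response I X) (X \<union> foll I)"
    using response_spanning_forest[OF I] X by (simp add: feasible_def)
  ultimately show "cycle_free I (X \<union> response I X)" "X \<union> response I X \<subseteq> edges I"
    "connects I (X \<union> response I X)"
    using X by (auto simp: spanning_forest_def edges_def feasible_def connects_def)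
qed

text \<open>As \<open>B\<close> is nonnegative, an upper bound on the number of edges is
  enough.\<close>

lemma threshold_cost:
  assumes I: "bmst_instance I" and X: "spanning_forest I X (cheap I B)" and B: "threshold I B" "0 \<le> B"
  shows "leader_cost I X \<le> (real (card (verts I)) - 1) * B"
proof -
  note f = threshold_feasible[OF I X B(1)]
  have "leader_cost I X \<le> of_nat (card (X \<union> response I X)) * B"
    unfolding leader_cost_def using f(2) by (intro sum_bounded_above) blast
  also have "\<dots> \<le> (real (card (verts I)) - 1) * B"
    using forest_card[OF I feasible_tree(2,1)[OF I f(1)]] B(2) by (intro mult_right_mono) auto
  finally show ?thesis .
qed

text \<open>A \<open>Min\<close> is meaningful for a finite nonempty set: choices are subsets of the
  finite \<open>lead I\<close>, and \<open>X0\<close> is one of the feasible ones.\<close>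

lemma OPT_attained:
  assumes "bmst_instance I" "feasible I X0"
  shows "\<exists>X. feasible I X \<and> OPT I = leader_cost I X"
proof -
  let ?S = "{leader_cost I X |X. feasible I X}"
  have "?S \<subseteq> leader_cost I ` Pow (lead I)" by (auto simp: feasible_def leader_choice_def)
  moreover have "finite (lead I)" using assms(1) by (simp add: bmst_instance_def)
  ultimately have "finite ?S" by (meson finite_Pow_iff finite_imageI finite_subset)
  moreover have "?S \<noteq> {}" using assms(2) by blast
  ultimately have "Min ?S \<in> ?S" by (rule Min_in)
  then show ?thesis by (auto simp: OPT_def)
qed

lemma OPT_nonneg:
  assumes I: "bmst_instance I" and X: "feasible I X0"
  shows "0 \<le> OPT I"
proof -
  obtain X where "feasible I X" "OPT I = leader_cost I X"
    using OPT_attained[OF assms] by blast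
  moreover have "\<forall>e\<in>edges I. 0 \<le> ccost I e"
    using I by (simp add: bmst_instance_def)
  ultimately show ?thesis
    using feasible_tree(2)[OF I] unfolding leader_cost_def by (metis subsetD sum_nonneg)
qed

lemma OPT_threshold:
  assumes I: "bmst_instance I" and X0: "feasible I X0" and ne: "edges I \<noteq> {}"
  shows "\<exists>e\<in>edges I. threshold I (ccost I e) \<and> ccost I e \<le> OPT I"
proof -
  obtain X where X: "feasible I X" "OPT I = leader_cost I X"
    using OPT_attained[OF I X0] by blast
  define F where "F = X \<union> response I X"
  have F: "F \<subseteq> edges I" "connects I F" using feasible_tree[OF I X(1)] by (simp_all add: F_def)
  have fin: "finite F" using F(1) finite_edges[OF I] by (rule finite_subset)
  obtain e where e: "e \<in> edges I" using ne by blast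
  obtain a b where ab: "ends I e = {a, b}" "a \<noteq> b" using edge_ends[OF I e] .
  have "(a, b) \<in> (adj I F)\<^sup>*"
    using linked_if_connects[OF I F(2) e] by (simp add: linked_iff[OF ab(1)])
  \<comment> \<open>The distinct ends of an edge must be joined by \<open>F\<close>, so
    \<open>F\<close> is nonempty and has a costliest member.\<close>
  then have "F \<noteq> {}" using ab(2) by (auto simp: adj_def)
  then obtain m where m: "m \<in> F" "\<And>x. x \<in> F \<Longrightarrow> ccost I x \<le> ccost I m"
    using fin Max_in[of "ccost I ` F"] Max_ge[of "ccost I ` F"] by fastforce
  have "threshold I (ccost I m)"
    using threshold_if_feasible[OF I X(1)] m(2) by (simp add: F_def)
  moreover have "ccost I m \<le> (\<Sum>x\<in>F. ccost I x)"
    using m(1) fin F(1) I by (intro member_le_sum) (auto simp: bmst_instance_def)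
  ultimately show ?thesis
    using m(1) F(1) X(2) by (auto simp: leader_cost_def F_def)
qed

section \<open>Time-bounded execution\<close>

text \<open>Total correctness with a time budget, in the shape of a weakest precondition. The simp
  rules for it are equivalences, so that the simplifier executes straight-line code
  symbolically.\<close>

definition runs :: "prog \<Rightarrow> memory \<Rightarrow> nat \<Rightarrow> (memory \<Rightarrow> bool) \<Rightarrow> bool" where
  "runs P s T Q \<longleftrightarrow> (\<exists>t s'. exec P s t s' \<and> t \<le> T \<and> Q s')"

lemma runs_Skip [simp]: "runs Skip s T Q \<longleftrightarrow> 1 \<le> T \<and> Q s"
  unfolding runs_def using exec.Skip[of s] by (fast elim: exec.cases)

lemma runs_NAssign [simp]:
  "runs (NAssign a i x) s T Q \<longleftrightarrow> 1 \<le> T \<and> Q (nstore a (nval i s) (nval x s) s)"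
  unfolding runs_def using exec.NAssign[of a i x s] by (fast elim: exec.cases)

lemma runs_Seq:
  assumes "runs P s T (\<lambda>s'. runs Q s' T' R)"
  shows "runs (Seq P Q) s (T + T') R"
  using assms unfolding runs_def by (meson add_mono exec.Seq)

text \<open>In \<open>runs_Seq\<close> the budget has to be split by hand; after an assignment the
  split is known, which makes the rule an equivalence.\<close>

lemma runs_Seq_NAssign [simp]:
  assumes "1 \<le> T"
  shows "runs (Seq (NAssign a i x) P) s T Q \<longleftrightarrow> runs P (nstore a (nval i s) (nval x s) s) (T - 1) Q"
    (is "?L \<longleftrightarrow> ?R")
proof
  assume ?L
  then obtain t s' where ex: "exec (Seq (NAssign a i x) P) s t s'" and *: "t \<le> T" "Q s'"
    by (auto simp: runs_def)
  from ex obtain t1 t2 s1 where "exec (NAssign a i x) s t1 s1" "exec P s1 t2 s'" "t = t1 + t2"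
    by (cases rule: exec.cases) auto
  moreover from this(1) have "t1 = 1 \<and> s1 = nstore a (nval i s) (nval x s) s"
    by (cases rule: exec.cases) auto
  ultimately show ?R using * unfolding runs_def by (intro exI[of _ t2] exI[of _ s']) auto
next
  assume ?R
  then have "runs (Seq (NAssign a i x) P) s (1 + (T - 1)) Q"
    by (intro runs_Seq) simp
  then show ?L using assms by simp
qed

lemma runs_Cond [simp]:
  assumes "1 \<le> T"
  shows "runs (Cond b P Q) s T R \<longleftrightarrow> (if bval b s then runs P s (T - 1) R else runs Q s (T - 1) R)"
    (is "?L \<longleftrightarrow> ?R")
proof
  assume ?L
  then obtain t s' where ex: "exec (Cond b P Q) s t s'" and *: "t \<le> T" "R s'"
    by (auto simp: runs_def)
  from ex show ?R
  proof (cases rule: exec.cases)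
    case (CondT t1)
    then show ?thesis using * unfolding runs_def by (auto intro!: exI[of _ t1] exI[of _ s'])
  next
    case (CondF t1)
    then show ?thesis using * unfolding runs_def by (auto intro!: exI[of _ t1] exI[of _ s'])
  qed
next
  assume ?R
  then obtain t s' where "exec (if bval b s then P else Q) s t s'" "t \<le> T - 1" "R s'"
    by (auto simp: runs_def split: if_splits)
  then have "exec (Cond b P Q) s (t + 1) s'" "t + 1 \<le> T"
    using assms by (auto intro: exec.CondT[unfolded Suc_eq_plus1] exec.CondF split: if_splits simp del: One_nat_def add_Suc_right)
  with \<open>R s'\<close> show ?L unfolding runs_def by blast
qed

lemma runs_weaken:
  "runs P s T Q \<Longrightarrow> T \<le> T' \<Longrightarrow> (\<And>s'. Q s' \<Longrightarrow> Q' s') \<Longrightarrow> runs P s T' Q'"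
  unfolding runs_def by (meson order_trans)

abbreviation var :: "nat \<Rightarrow> nexp" where
  "var a \<equiv> NCell a (NConst 0)"

abbreviation assign :: "nat \<Rightarrow> nexp \<Rightarrow> prog" where
  "assign a x \<equiv> NAssign a (NConst 0) x"

text \<open>The counter is not initialised here, so that \<open>follower_phase\<close> can continue
  where \<open>leader_phase\<close> stopped.\<close>

definition for_loop :: "nat \<Rightarrow> nexp \<Rightarrow> prog \<Rightarrow> prog" where
  "for_loop a h P =
     Loop (NLess (var a) h) (Seq P (assign a (NAdd (var a) (NConst 1))))"

text \<open>Beyond \<open>T\<close>, a round pays one unit for the test and one for the increment;
  the final 1 is the failing test. \<open>N\<close> only bounds the number of rounds, so that all
  loops can be charged to the input size.\<close>

lemma runs_for_loop:
  assumes "Inv lo s" "lo \<le> hi" "hi - lo \<le> N" "N * (T + 2) + 1 \<le> T'"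
    and count: "\<And>k s. Inv k s \<Longrightarrow> nmem s a 0 = k \<and> nval h s = hi"
    and body: "\<And>k s. lo \<le> k \<Longrightarrow> k < hi \<Longrightarrow> Inv k s \<Longrightarrow>
      runs P s T (\<lambda>s'. Inv (Suc k) (nstore a 0 (Suc (nmem s' a 0)) s'))"
  shows "runs (for_loop a h P) s T' (Inv hi)"
proof -
  define B where "B = Seq P (assign a (NAdd (var a) (NConst 1)))"
  have "runs (Loop (NLess (var a) h) B) s (j * (T + 2) + 1) (Inv hi)"
    if "Inv k s" "lo \<le> k" "k + j = hi" for j k s
    using that
  proof (induction j arbitrary: k s)
    case 0
    then have "\<not> bval (NLess (var a) h) s" using count[of k s] by simp
    then have "exec (Loop (NLess (var a) h) B) s 1 s" by (rule exec.LoopF)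
    moreover have "Inv hi s" using 0 by simp
    ultimately show ?case unfolding runs_def by (metis mult_0 add_0 order_refl)
  next
    case (Suc j)
    then have b: "bval (NLess (var a) h) s" using count[of k s] by simp
    have "runs B s (T + 1) (Inv (Suc k))"
      unfolding B_def using body[of k s] Suc.prems by (intro runs_Seq) simp
    then obtain t s' where s': "exec B s t s'" "t \<le> T + 1" "Inv (Suc k) s'"
      by (auto simp: runs_def)
    then obtain t' s'' where "exec (Loop (NLess (var a) h) B) s' t' s''" "t' \<le> j * (T + 2) + 1" "Inv hi s''"
      using Suc.IH[of "Suc k" s'] Suc.prems by (auto simp: runs_def)
    then show ?case
      using exec.LoopT[OF b s'(1)] s'(2) unfolding runs_def
      by (intro exI[of _ "t + t' + 1"] exI[of _ s'']) auto
  qed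
  from this[of lo s "hi - lo"] have "runs (for_loop a h P) s ((hi - lo) * (T + 2) + 1) (Inv hi)"
    unfolding for_loop_def B_def[symmetric] using assms(1,2) by simp
  moreover have "(hi - lo) * (T + 2) + 1 \<le> T'"
    using mult_le_mono1[OF assms(3), of "T + 2"] assms(4) by linarith
  ultimately show ?thesis by (rule runs_weaken)
qed

lemma nmem_nstore [simp]: "nmem (nstore a i x s) b = (if b = a then (nmem s a)(i := x) else nmem s b)"
  by (simp add: nstore_def)

lemma rmem_nstore [simp]: "rmem (nstore a i x s) = rmem s"
  by (simp add: nstore_def)

text \<open>A frame condition on whole arrays; the real memory stays fixed because the program never
  assigns to it.\<close>

definition same_except :: "nat set \<Rightarrow> memory \<Rightarrow> memory \<Rightarrow> bool" where
  "same_except K s s' \<longleftrightarrow> rmem s' = rmem s \<and> (\<forall>k. k \<notin> K \<longrightarrow> nmem s' k = nmem s k)"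

section \<open>The program\<close>

text \<open>Besides the input and output arrays, the program uses array 4 for the component labels of the
  vertices and cell 0 of the following arrays: 5 for the current edge, 6 for the edge whose cost is
  the threshold, 7 for the current vertex, 8 and 9 for the labels being merged, 10 for the failure
  flag of a trial, 11 for the best threshold edge found and 12 to tell whether there is one.\<close>

definition label_of :: "nat \<Rightarrow> nexp" where
  "label_of k = NCell 4 (NCell k (var 5))"

definition differ :: "nexp \<Rightarrow> nexp \<Rightarrow> bexp" where
  "differ x y = BNot (BAnd (BNot (NLess x y)) (BNot (NLess y x)))"

definition costlier :: "nat \<Rightarrow> nat \<Rightarrow> bexp" where
  "costlier a b = RLess (RCell 0 (var b)) (RCell 0 (var a))"

text \<open>The old labels are saved first, since the loop changes the label of the second end while
  still comparing with it.\<close>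

definition merge :: prog where
  "merge = Seq (assign 8 (label_of 1)) (Seq (assign 9 (label_of 2)) (Seq (assign 7 (NConst 0))
     (for_loop 7 (var 0)
       (Cond (differ (NCell 4 (var 7)) (var 9)) Skip (NAssign 4 (var 7) (var 8))))))"

definition init_labels :: prog where
  "init_labels = Seq (assign 7 (NConst 0)) (for_loop 7 (var 0) (NAssign 4 (var 7) (var 7)))"

text \<open>The mark is cleared first because array 3 still holds the marks of the previous
  trial.\<close>

definition leader_phase :: prog where
  "leader_phase = Seq (assign 5 (NConst 0)) (for_loop 5 (NCell 0 (NConst 1))
     (Seq (NAssign 3 (var 5) (NConst 0))
       (Cond (costlier 5 6) Skip
         (Seq (Cond (differ (label_of 1) (label_of 2)) (NAssign 3 (var 5) (NConst 1)) Skip) merge))))"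

text \<open>The test precedes the merge because only earlier follower's edges may exclude an edge.
  The merge is unconditional: an edge outside the response has linked ends anyway.\<close>

definition follower_phase :: prog where
  "follower_phase = for_loop 5 (NAdd (NCell 0 (NConst 1)) (NCell 0 (NConst 2)))
     (Seq (Cond (BAnd (costlier 5 6) (differ (label_of 1) (label_of 2))) (assign 10 (NConst 1)) Skip)
       merge)"

text \<open>This decides feasibility; follower's edges link their own ends, so testing the leader's
  edges suffices.\<close>

definition connection_phase :: prog where
  "connection_phase = Seq (assign 5 (NConst 0)) (for_loop 5 (NCell 0 (NConst 1))
     (Cond (differ (label_of 1) (label_of 2)) (assign 10 (NConst 1)) Skip))"

definition trial :: prog where
  "trial = Seq init_labels (Seq (assign 10 (NConst 0))
     (Seq leader_phase (Seq follower_phase connection_phase)))"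

text \<open>Candidates need no sorting, as the cheapest successful one is kept while scanning. Later
  trials overwrite array 3, hence the final trial, which restores the marks for the best
  threshold.\<close>

definition algorithm :: prog where
  "algorithm =
     Seq (for_loop 6 (NAdd (NCell 0 (NConst 1)) (NCell 0 (NConst 2)))
       (Seq trial
         (Cond (BAnd (NLess (var 10) (NConst 1))
                  (BNot (BAnd (NLess (NConst 0) (var 12)) (BNot (costlier 11 6)))))
           (Seq (assign 11 (var 6)) (assign 12 (NConst 1))) Skip)))
     (Seq (assign 6 (var 11)) trial)"

lemma bval_differ [simp]: "bval (differ x y) s \<longleftrightarrow> nval x s \<noteq> nval y s"
  by (auto simp: differ_def)

lemma bval_costlier [simp]:
  "bval (costlier a b) s \<longleftrightarrow> rmem s 0 (nmem s b 0) < rmem s 0 (nmem s a 0)"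
  by (simp add: costlier_def)

lemma nval_label_of [simp]: "nval (label_of k) s = nmem s 4 (nmem s k (nmem s 5 0))"
  by (simp add: label_of_def)

text \<open>The part of the output settled after \<open>k\<close> rounds; stale marks at later
  positions are ignored.\<close>

definition marked :: "'e list \<Rightarrow> (nat \<Rightarrow> nat) \<Rightarrow> nat \<Rightarrow> 'e set" where
  "marked ls f k = {ls ! q |q. q < k \<and> f q \<noteq> 0}"

lemma marked_Suc:
  "marked ls (f(k := x)) (Suc k) = (if x = 0 then marked ls f k else insert (ls ! k) (marked ls f k))"
  by (auto simp: marked_def less_Suc_eq)

lemma decode_eq_marked: "decode ls s = marked ls (nmem s 3) (length ls)"
  by (simp add: decode_def marked_def)

section \<open>Correctness and running time of a trial\<close>

locale encoded =
  fixes I :: "('v, 'e) bmst" and vs :: "'v list" and ls :: "'e list" and s0 :: memory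
  assumes inst: "bmst_instance I" and enc: "encodes I vs ls s0"
begin

abbreviation "es \<equiv> ls @ ford I"

definition "size_bound = card (verts I) + card (edges I)"

lemma sizes: "nmem s0 0 0 = length vs" "nmem s0 0 (Suc 0) = length ls" "nmem s0 0 2 = length (ford I)"
  using enc by (simp_all add: encodes_def Let_def)

lemma edge_input:
  assumes "i < length es"
  shows "nmem s0 (Suc 0) i < length vs" "nmem s0 2 i < length vs"
    "ends I (es ! i) = {vs ! nmem s0 (Suc 0) i, vs ! nmem s0 2 i}"
    "rmem s0 0 i = ccost I (es ! i)" "es ! i \<in> edges I"
  using enc assms nth_mem[OF assms] by (auto simp: encodes_def Let_def edges_def foll_def)

lemma enumerations: "distinct vs" "set vs = verts I" "distinct ls" "set ls = lead I" "set es = edges I"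
  "distinct es"
  using enc inst by (auto simp: encodes_def edges_def foll_def bmst_instance_def)

lemma size_bound_ge: "length vs \<le> size_bound" "length es \<le> size_bound"
  unfolding size_bound_def using enumerations distinct_card by (metis le_add1, metis le_add2)

text \<open>The part of \<open>encodes\<close> that persists: after the first writes the working
  arrays are no longer zero.\<close>

definition input :: "memory \<Rightarrow> bool" where
  "input s \<longleftrightarrow> rmem s = rmem s0 \<and> nmem s 0 = nmem s0 0 \<and> nmem s (Suc 0) = nmem s0 (Suc 0) \<and> nmem s 2 = nmem s0 2"

lemma labels_differ:
  assumes "input s" "nmem s 5 0 < length es" "labels I vs F (nmem s 4)"
  shows "nmem s 4 (nmem s (Suc 0) (nmem s 5 0)) = nmem s 4 (nmem s 2 (nmem s 5 0)) \<longleftrightarrow>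
    linked I F (es ! nmem s 5 0)"
  using assms edge_input[OF assms(2)] linked_iff[OF edge_input(3)[OF assms(2)]]
  by (simp add: labels_def input_def)

lemma runs_merge:
  assumes s: "input s" "nmem s 5 0 < length es" "labels I vs F (nmem s 4)"
  shows "runs merge s (4 * size_bound + 4)
    (\<lambda>s'. same_except {4,7,8,9} s s' \<and> labels I vs (insert (es ! nmem s 5 0) F) (nmem s' 4))"
proof -
  define a where "a = nmem s0 (Suc 0) (nmem s 5 0)"
  define b where "b = nmem s0 2 (nmem s 5 0)"
  define f where "f = nmem s 4"
  define Inv where "Inv k s' \<longleftrightarrow> same_except {4,7,8,9} s s' \<and> nmem s' 7 0 = k \<and>
    nmem s' 8 0 = f a \<and> nmem s' 9 0 = f b \<and>
    (\<forall>u. nmem s' 4 u = (if u < k \<and> f u = f b then f a else f u))" for k s'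
  define s1 where "s1 = nstore 7 0 0 (nstore 9 0 (f b) (nstore 8 0 (f a) s))"
  have "runs (for_loop 7 (var 0)
      (Cond (differ (NCell 4 (var 7)) (var 9)) Skip (NAssign 4 (var 7) (var 8)))) s1
      (4 * size_bound + 1) (Inv (length vs))"
  proof (rule runs_for_loop[where lo = 0 and N = size_bound and T = 2])
    show "Inv 0 s1" by (simp add: Inv_def s1_def same_except_def f_def)
    show "length vs - 0 \<le> size_bound" using size_bound_ge by simp
    show "nmem s' 7 0 = k \<and> nval (var 0) s' = length vs" if "Inv k s'" for k s'
      using that s sizes by (simp add: Inv_def same_except_def input_def)
    show "runs (Cond (differ (NCell 4 (var 7)) (var 9)) Skip (NAssign 4 (var 7) (var 8))) s' 2
      (\<lambda>s''. Inv (Suc k) (nstore 7 0 (Suc (nmem s'' 7 0)) s''))" if "Inv k s'" for k s'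
      using that by (auto simp: Inv_def same_except_def less_Suc_eq)
  qed simp_all
  then have "runs merge s (4 * size_bound + 4) (Inv (length vs))"
    using s(1) by (simp add: merge_def s1_def a_def b_def f_def input_def)
  moreover have "labels I vs (insert (es ! nmem s 5 0) F) (nmem s' 4)" if "Inv (length vs) s'" for s'
    using labels_insert[OF s(3) edge_input(3,1,2)[OF s(2)]] that
    by (simp add: Inv_def f_def a_def b_def)
  ultimately show ?thesis
    by (auto elim!: runs_weaken simp: Inv_def)
qed

lemma runs_init_labels:
  assumes s: "input s"
  shows "runs init_labels s (3 * size_bound + 2)
    (\<lambda>s'. same_except {4,7} s s' \<and> labels I vs {} (nmem s' 4))"
proof -
  define Inv where "Inv k s' \<longleftrightarrow> same_except {4,7} s s' \<and> nmem s' 7 0 = k \<and> (\<forall>u<k. nmem s' 4 u = u)"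
    for k s'
  have "runs (for_loop 7 (var 0) (NAssign 4 (var 7) (var 7))) (nstore 7 0 0 s)
    (3 * size_bound + 1) (Inv (length vs))"
  proof (rule runs_for_loop[where lo = 0 and N = size_bound and T = 1])
    show "Inv 0 (nstore 7 0 0 s)" by (simp add: Inv_def same_except_def)
    show "length vs - 0 \<le> size_bound" using size_bound_ge by simp
    show "nmem s' 7 0 = k \<and> nval (var 0) s' = length vs" if "Inv k s'" for k s'
      using that s sizes by (simp add: Inv_def same_except_def input_def)
    show "runs (NAssign 4 (var 7) (var 7)) s' 1
      (\<lambda>s''. Inv (Suc k) (nstore 7 0 (Suc (nmem s'' 7 0)) s''))" if "Inv k s'" for k s'
      using that by (auto simp: Inv_def same_except_def)
  qed simp_all
  then have "runs init_labels s (3 * size_bound + 2) (Inv (length vs))"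
    by (simp add: init_labels_def)
  then show ?thesis
    by (rule runs_weaken) (auto simp: Inv_def intro: labels_empty[OF enumerations(1)])
qed

lemma same_except_trans:
  "same_except K s s1 \<Longrightarrow> same_except L s1 s2 \<Longrightarrow> K \<union> L \<subseteq> M \<Longrightarrow> same_except M s s2"
  unfolding same_except_def by (metis UnCI subsetD)

lemma decode_same_except: "same_except K s s' \<Longrightarrow> 3 \<notin> K \<Longrightarrow> decode ls s' = decode ls s"
  by (simp add: same_except_def decode_def)

lemma input_same_except: "input s \<Longrightarrow> same_except K s s' \<Longrightarrow> K \<inter> {0, Suc 0, 2} = {} \<Longrightarrow> input s'"
  by (auto simp: input_def same_except_def)

text \<open>The labels decide whether marking the next edge keeps the marked set a forest. A round
  costs at most 1 for clearing the mark, 1 for the cost test, 2 for the link test with marking,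
  \<open>4 * size_bound + 4\<close> for \<open>merge\<close>, and 2 for the loop.\<close>

lemma runs_leader_phase:
  assumes s: "input s" "labels I vs {} (nmem s 4)" and B: "B = rmem s0 0 (nmem s 6 0)"
  shows "runs leader_phase s (size_bound * (4 * size_bound + 10) + 2)
    (\<lambda>s'. same_except {3,4,5,7,8,9} s s' \<and> nmem s' 5 0 = length ls \<and>
      labels I vs (cheap I B) (nmem s' 4) \<and> spanning_forest I (decode ls s') (cheap I B))"
proof -
  define C where "C k = {e \<in> set (take k ls). ccost I e \<le> B}" for k
  define Inv where "Inv k s' \<longleftrightarrow> same_except {3,4,5,7,8,9} s s' \<and> nmem s' 5 0 = k \<and>
    labels I vs (C k) (nmem s' 4) \<and> spanning_forest I (marked ls (nmem s' 3) k) (C k)" for k s'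
  define P where "P = Seq (NAssign 3 (var 5) (NConst 0)) (Cond (costlier 5 6) Skip
    (Seq (Cond (differ (label_of 1) (label_of 2)) (NAssign 3 (var 5) (NConst 1)) Skip) merge))"
  have "runs (for_loop 5 (NCell 0 (NConst 1)) P) (nstore 5 0 0 s)
    (size_bound * (4 * size_bound + 10) + 1) (Inv (length ls))"
  proof (rule runs_for_loop[where lo = 0 and N = size_bound and T = "4 * size_bound + 8"])
    show "Inv 0 (nstore 5 0 0 s)"
      using s(2) cycle_free_empty
      by (auto simp: Inv_def same_except_def C_def marked_def spanning_forest_def)
    show "length ls - 0 \<le> size_bound" using size_bound_ge by simp
    show "nmem s' 5 0 = k \<and> nval (NCell 0 (NConst 1)) s' = length ls" if "Inv k s'" for k s'
      using that s sizes by (simp add: Inv_def same_except_def input_def)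
  next
    fix k s' assume k: "k < length ls" and inv: "Inv k s'"
    let ?Q = "\<lambda>s''. Inv (Suc k) (nstore 5 0 (Suc (nmem s'' 5 0)) s'')"
    define e where "e = ls ! k"
    have e: "es ! k = e" "k < length es" using k by (simp_all add: e_def nth_append)
    have cost: "rmem s' 0 k = ccost I e" "rmem s' 0 (nmem s' 6 0) = B" "nmem s' 5 0 = k" "input s'"
      using inv s(1) edge_input(4)[OF e(2)] e(1) B by (auto simp: Inv_def same_except_def input_def)
    have take: "take (Suc k) ls = take k ls @ [e]" using k by (simp add: e_def take_Suc_conv_app_nth)
    define s1 where "s1 = nstore 3 k 0 s'"
    show "runs P s' (4 * size_bound + 8) ?Q"
    proof (cases "B < ccost I e")
      case True
      then have "C (Suc k) = C k" by (auto simp: C_def take)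
      then have "?Q s1"
        using inv by (simp add: Inv_def s1_def marked_Suc) (simp add: same_except_def)
      then show ?thesis using True cost by (simp add: P_def s1_def)
    next
      case False
      then have CS: "C (Suc k) = insert e (C k)" by (auto simp: C_def take)
      \<comment> \<open>The memory between marking and merging, described by \<open>linked\<close>
        so that the forest argument is free of the machine.\<close>
      define s2 where "s2 = (if linked I (C k) e then s1 else nstore 3 k 1 s1)"
      have "distinct (take (Suc k) ls)" using enumerations(3) by (rule distinct_take)
      then have "e \<notin> C k" by (auto simp: take C_def)
      obtain a b where ab: "ends I e = {a, b}" "a \<noteq> b"
        using edge_ends[OF inst edge_input(5)[OF e(2)]] e(1) by auto
      have "marked ls (nmem s2 3) (Suc k) =
          (if linked I (C k) e then marked ls (nmem s' 3) k else insert e (marked ls (nmem s' 3) k))"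
        by (simp add: s2_def s1_def marked_Suc e_def)
      then have forest: "spanning_forest I (marked ls (nmem s2 3) (Suc k)) (C (Suc k))"
        using spanning_forest_insert[OF _ ab \<open>e \<notin> C k\<close>, of "marked ls (nmem s' 3) k"] inv
        by (simp add: CS Inv_def linked_iff[OF ab(1)])
      have s2: "same_except {3} s' s2" by (simp add: s2_def s1_def same_except_def)
      then have *: "input s2" "nmem s2 5 0 = k" "labels I vs (C k) (nmem s2 4)"
        using cost inv input_same_except[OF cost(4) s2] by (auto simp: same_except_def Inv_def)
      have "runs merge s2 (4 * size_bound + 4) ?Q"
      proof (rule runs_weaken[OF runs_merge[OF *(1) _ *(3)]])
        fix s'' assume "same_except {4,7,8,9} s2 s'' \<and> labels I vs (insert (es ! nmem s2 5 0) (C k)) (nmem s'' 4)"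
        then show "?Q s''"
          using inv s2 forest * e(1) by (simp add: Inv_def same_except_def CS)
      qed (use * e in simp_all)
      then have "runs (Seq (Cond (differ (label_of 1) (label_of 2)) (NAssign 3 (var 5) (NConst 1)) Skip)
          merge) s1 (2 + (4 * size_bound + 4)) ?Q"
        using labels_differ[of s1 "C k"] cost inv e
        by (intro runs_Seq) (auto simp: s1_def s2_def input_def Inv_def)
      then show ?thesis
        using False cost by (auto simp: P_def s1_def elim!: runs_weaken)
    qed
  qed (simp_all add: algebra_simps)
  then have "runs leader_phase s (size_bound * (4 * size_bound + 10) + 2) (Inv (length ls))"
    by (simp add: leader_phase_def P_def)
  moreover have "C (length ls) = cheap I B"
    using enumerations(4) by (simp add: C_def cheap_def)
  ultimately show ?thesis
    by (auto elim!: runs_weaken simp: Inv_def decode_eq_marked)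
qed

lemma runs_follower_phase:
  assumes s: "input s" "labels I vs F (nmem s 4)" "nmem s 5 0 = length ls" "nmem s 10 0 = 0"
    and B: "B = rmem s0 0 (nmem s 6 0)"
  shows "runs follower_phase s (size_bound * (4 * size_bound + 8) + 1)
    (\<lambda>s'. same_except {4,5,7,8,9,10} s s' \<and> labels I vs (F \<union> foll I) (nmem s' 4) \<and>
      (nmem s' 10 0 = 0 \<longleftrightarrow> (\<forall>q<length (ford I). B < ccost I (ford I ! q) \<longrightarrow>
        linked I (F \<union> set (take q (ford I))) (ford I ! q))))"
proof -
  define G where "G k = F \<union> set (take k (ford I))" for k
  \<comment> \<open>The edge counter starts at \<open>length ls\<close>; the difference turns it
    into a position in \<open>ford I\<close>.\<close>
  define Inv where "Inv k s' \<longleftrightarrow> same_except {4,5,7,8,9,10} s s' \<and> nmem s' 5 0 = k \<and>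
    labels I vs (G (k - length ls)) (nmem s' 4) \<and>
    (nmem s' 10 0 = 0 \<longleftrightarrow> (\<forall>q<k - length ls. B < ccost I (ford I ! q) \<longrightarrow> linked I (G q) (ford I ! q)))"
    for k s'
  define P where "P = Seq (Cond (BAnd (costlier 5 6) (differ (label_of 1) (label_of 2)))
    (assign 10 (NConst 1)) Skip) merge"
  have "runs (for_loop 5 (NAdd (NCell 0 (NConst 1)) (NCell 0 (NConst 2))) P) s
    (size_bound * (4 * size_bound + 8) + 1) (Inv (length es))"
  proof (rule runs_for_loop[where lo = "length ls" and N = size_bound and T = "4 * size_bound + 6"])
    show "Inv (length ls) s"
      using s by (simp add: Inv_def same_except_def G_def)
    show "length es - length ls \<le> size_bound" using size_bound_ge by simp
    show "nmem s' 5 0 = k \<and> nval (NAdd (NCell 0 (NConst 1)) (NCell 0 (NConst 2))) s' = length es"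
      if "Inv k s'" for k s'
      using that s sizes by (simp add: Inv_def same_except_def input_def)
  next
    fix k s' assume k: "length ls \<le> k" "k < length es" and inv: "Inv k s'"
    let ?Q = "\<lambda>s''. Inv (Suc k) (nstore 5 0 (Suc (nmem s'' 5 0)) s'')"
    define q where "q = k - length ls"
    have q: "q < length (ford I)" "Suc k - length ls = Suc q" using k by (auto simp: q_def)
    define e where "e = ford I ! q"
    have e: "es ! k = e" using k by (simp add: e_def nth_append q_def)
    have GS: "G (Suc q) = insert e (G q)"
      using q(1) by (simp add: G_def e_def take_Suc_conv_app_nth)
    have cost: "rmem s' 0 k = ccost I e" "rmem s' 0 (nmem s' 6 0) = B" "nmem s' 5 0 = k" "input s'"
      using inv s(1) edge_input(4)[OF k(2)] e B by (auto simp: Inv_def same_except_def input_def)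
    define s1 where "s1 = (if B < ccost I e \<and> \<not> linked I (G q) e then nstore 10 0 1 s' else s')"
    have s1: "same_except {10} s' s1" by (simp add: s1_def same_except_def)
    then have *: "input s1" "nmem s1 5 0 = k" "labels I vs (G q) (nmem s1 4)"
      using cost inv input_same_except[OF cost(4) s1] by (auto simp: same_except_def Inv_def q_def)
    have flag: "nmem s1 10 0 = 0 \<longleftrightarrow>
      (\<forall>q'<Suc q. B < ccost I (ford I ! q') \<longrightarrow> linked I (G q') (ford I ! q'))"
      using inv by (auto simp: s1_def Inv_def less_Suc_eq e_def q_def[symmetric])
    have "runs merge s1 (4 * size_bound + 4) ?Q"
    proof (rule runs_weaken[OF runs_merge[OF *(1) _ *(3)]])
      fix s'' assume "same_except {4,7,8,9} s1 s'' \<and> labels I vs (insert (es ! nmem s1 5 0) (G q)) (nmem s'' 4)"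
      then show "?Q s''"
        using inv s1 flag * e by (simp add: Inv_def same_except_def q(2) GS)
    qed (use * k in simp_all)
    then have "runs P s' (2 + (4 * size_bound + 4)) ?Q"
      unfolding P_def using labels_differ[of s' "G q"] cost inv e k
      by (intro runs_Seq) (auto simp: s1_def Inv_def q_def)
    then show "runs P s' (4 * size_bound + 6) ?Q" by (elim runs_weaken) simp_all
  qed (simp_all add: algebra_simps)
  then have "runs follower_phase s (size_bound * (4 * size_bound + 8) + 1) (Inv (length es))"
    by (simp add: follower_phase_def P_def)
  then show ?thesis
    by (auto elim!: runs_weaken simp: Inv_def G_def foll_def)
qed

text \<open>Links are read off the final labels, which this phase leaves alone; the flag may already
  have been set by the follower's phase.\<close>

lemma runs_connection_phase:
  assumes s: "input s" "labels I vs F (nmem s 4)"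
  shows "runs connection_phase s (4 * size_bound + 2)
    (\<lambda>s'. same_except {5,10} s s' \<and>
      (nmem s' 10 0 = 0 \<longleftrightarrow> nmem s 10 0 = 0 \<and> (\<forall>e\<in>lead I. linked I F e)))"
proof -
  define Inv where "Inv k s' \<longleftrightarrow> same_except {5,10} s s' \<and> nmem s' 5 0 = k \<and>
    (nmem s' 10 0 = 0 \<longleftrightarrow> nmem s 10 0 = 0 \<and> (\<forall>q<k. linked I F (ls ! q)))" for k s'
  define P where "P = Cond (differ (label_of 1) (label_of 2)) (assign 10 (NConst 1)) Skip"
  have "runs (for_loop 5 (NCell 0 (NConst 1)) P) (nstore 5 0 0 s)
    (4 * size_bound + 1) (Inv (length ls))"
  proof (rule runs_for_loop[where lo = 0 and N = size_bound and T = 2])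
    show "Inv 0 (nstore 5 0 0 s)" by (simp add: Inv_def same_except_def)
    show "length ls - 0 \<le> size_bound" using size_bound_ge by simp
    show "nmem s' 5 0 = k \<and> nval (NCell 0 (NConst 1)) s' = length ls" if "Inv k s'" for k s'
      using that s sizes by (simp add: Inv_def same_except_def input_def)
  next
    fix k s' assume k: "k < length ls" and inv: "Inv k s'"
    have same: "same_except {5,10} s s'" "nmem s' 5 0 = k" using inv by (simp_all add: Inv_def)
    have "nmem s' 4 (nmem s' (Suc 0) k) = nmem s' 4 (nmem s' 2 k) \<longleftrightarrow> linked I F (ls ! k)"
      using labels_differ[of s' F] input_same_except[OF s(1) same(1)] same k s(2)
      by (simp add: nth_append same_except_def)
    then show "runs P s' 2 (\<lambda>s''. Inv (Suc k) (nstore 5 0 (Suc (nmem s'' 5 0)) s''))"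
      using inv by (auto simp: P_def Inv_def same_except_def less_Suc_eq)
  qed simp_all
  then have "runs connection_phase s (4 * size_bound + 2) (Inv (length ls))"
    by (simp add: connection_phase_def P_def)
  moreover have "(\<forall>q<length ls. linked I F (ls ! q)) \<longleftrightarrow> (\<forall>e\<in>lead I. linked I F e)"
    unfolding enumerations(4)[symmetric] by (simp add: all_set_conv_all_nth)
  ultimately show ?thesis
    by (auto elim!: runs_weaken simp: Inv_def)
qed

definition trial_time :: nat where
  "trial_time = 8 * size_bound * size_bound + 25 * size_bound + 8"

lemma runs_trial:
  assumes s: "input s" and B: "B = rmem s0 0 (nmem s 6 0)"
  shows "runs trial s trial_time
    (\<lambda>s'. same_except {3,4,5,7,8,9,10} s s' \<and> spanning_forest I (decode ls s') (cheap I B) \<and>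
      (nmem s' 10 0 = 0 \<longleftrightarrow> threshold I B))"
    (is "runs _ _ _ ?Q")
proof -
  \<comment> \<open>Each phase has the correctness of all later ones as its postcondition, so the
    phases are treated from the last one backwards.\<close>
  have connection: "runs connection_phase s4 (4 * size_bound + 2) ?Q"
    if "same_except {3,4,5,7,8,9,10} s s4" "labels I vs (cheap I B \<union> foll I) (nmem s4 4)"
      "spanning_forest I (decode ls s4) (cheap I B)"
      "nmem s4 10 0 = 0 \<longleftrightarrow> (\<forall>q<length (ford I). B < ccost I (ford I ! q) \<longrightarrow>
        linked I (cheap I B \<union> set (take q (ford I))) (ford I ! q))" for s4
    by (rule runs_weaken[OF runs_connection_phase[OF input_same_except[OF s that(1)] that(2)]])
      (use that in \<open>auto simp: same_except_def decode_def threshold_def\<close>)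
  have follower: "runs (Seq follower_phase connection_phase) s3
      (size_bound * (4 * size_bound + 8) + 1 + (4 * size_bound + 2)) ?Q"
    if "same_except {3,4,5,7,8,9,10} s s3" "labels I vs (cheap I B) (nmem s3 4)" "nmem s3 5 0 = length ls"
      "nmem s3 10 0 = 0" "spanning_forest I (decode ls s3) (cheap I B)" for s3
  proof (rule runs_Seq, rule runs_weaken[OF runs_follower_phase[OF input_same_except[OF s that(1)] that(2-4) refl] order_refl])
    \<comment> \<open>The phase takes its threshold from array 6 of its own initial memory, which no
      phase writes.\<close>
    have threshold_cell: "rmem s0 0 (nmem s3 6 0) = B" using that(1) B by (simp add: same_except_def)
    fix s4
    assume s4: "same_except {4,5,7,8,9,10} s3 s4 \<and> labels I vs (cheap I B \<union> foll I) (nmem s4 4) \<and>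
      (nmem s4 10 0 = 0 \<longleftrightarrow> (\<forall>q<length (ford I). rmem s0 0 (nmem s3 6 0) < ccost I (ford I ! q) \<longrightarrow>
        linked I (cheap I B \<union> set (take q (ford I))) (ford I ! q)))"
    then have same: "same_except {4,5,7,8,9,10} s3 s4" by blast
    show "runs connection_phase s4 (4 * size_bound + 2) ?Q"
      by (rule connection[OF same_except_trans[OF that(1) same]])
        (use s4 that(5) decode_same_except[OF same] threshold_cell in simp_all)
  qed simp
  have leader: "runs (Seq leader_phase (Seq follower_phase connection_phase)) s2
      (size_bound * (4 * size_bound + 10) + 2 +
        (size_bound * (4 * size_bound + 8) + 1 + (4 * size_bound + 2))) ?Q"
    if "same_except {3,4,5,7,8,9,10} s s2" "labels I vs {} (nmem s2 4)" "nmem s2 10 0 = 0" for s2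
  proof (rule runs_Seq, rule runs_weaken[OF runs_leader_phase[OF input_same_except[OF s that(1)] that(2) refl] order_refl])
    have threshold_cell: "rmem s0 0 (nmem s2 6 0) = B" using that(1) B by (simp add: same_except_def)
    fix s3
    assume s3: "same_except {3,4,5,7,8,9} s2 s3 \<and> nmem s3 5 0 = length ls \<and>
      labels I vs (cheap I (rmem s0 0 (nmem s2 6 0))) (nmem s3 4) \<and>
      spanning_forest I (decode ls s3) (cheap I (rmem s0 0 (nmem s2 6 0)))"
    then have same: "same_except {3,4,5,7,8,9} s2 s3" by blast
    then have "nmem s3 10 0 = 0" using that(3) by (simp add: same_except_def)
    then show "runs (Seq follower_phase connection_phase) s3
        (size_bound * (4 * size_bound + 8) + 1 + (4 * size_bound + 2)) ?Q"
      by (intro follower[OF same_except_trans[OF that(1) same]])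
        (use s3 threshold_cell in simp_all)
  qed simp
  have init: "runs (Seq (assign 10 (NConst 0)) (Seq leader_phase (Seq follower_phase connection_phase))) s1
      (1 + (size_bound * (4 * size_bound + 10) + 2 +
        (size_bound * (4 * size_bound + 8) + 1 + (4 * size_bound + 2)))) ?Q"
    if "same_except {4,7} s s1 \<and> labels I vs {} (nmem s1 4)" for s1
    by (rule runs_Seq, rule runs_NAssign[THEN iffD2], intro conjI order_refl leader)
      (use that in \<open>auto simp: same_except_def\<close>)
  have "runs trial s (3 * size_bound + 2 + (1 + (size_bound * (4 * size_bound + 10) + 2 +
      (size_bound * (4 * size_bound + 8) + 1 + (4 * size_bound + 2))))) ?Q"
    unfolding trial_def
    by (rule runs_Seq, rule runs_weaken[OF runs_init_labels[OF s] order_refl], rule init)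
  then show ?thesis
    by (rule runs_weaken) (simp_all add: trial_time_def algebra_simps)
qed

section \<open>The search for the least threshold\<close>

text \<open>Each candidate costs a trial, at most 3 units for updating the best one and 2 for the
  loop; the remaining 2 are the failing test and the assignment before the final trial.\<close>

definition total_time :: nat where
  "total_time = size_bound * (trial_time + 5) + trial_time + 2"

lemma runs_algorithm:
  "runs algorithm s0 total_time (\<lambda>s'. \<exists>B. 0 \<le> B \<and> threshold I B \<and> spanning_forest I (decode ls s') (cheap I B) \<and>
     (edges I = {} \<longrightarrow> B = 0) \<and> (\<forall>e\<in>edges I. threshold I (ccost I e) \<longrightarrow> B \<le> ccost I e))"
    (is "runs _ _ _ ?Q")
proof -
  define c where "c = rmem s0 0"
  define Inv where "Inv k s \<longleftrightarrow> same_except {3,4,5,6,7,8,9,10,11,12} s0 s \<and> nmem s 6 0 = k \<and>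
    (nmem s 12 0 = 0 \<longrightarrow> nmem s 11 0 = 0 \<and> (\<forall>j<k. \<not> threshold I (c j))) \<and>
    (nmem s 12 0 \<noteq> 0 \<longrightarrow> nmem s 11 0 < k \<and> threshold I (c (nmem s 11 0)) \<and>
      (\<forall>j<k. threshold I (c j) \<longrightarrow> c (nmem s 11 0) \<le> c j))" for k s
  define P where "P = Seq trial
    (Cond (BAnd (NLess (var 10) (NConst 1)) (BNot (BAnd (NLess (NConst 0) (var 12)) (BNot (costlier 11 6)))))
      (Seq (assign 11 (var 6)) (assign 12 (NConst 1))) Skip)"
  have input: "input s" if "Inv k s" for k s
    using that by (simp add: Inv_def same_except_def input_def)
  have "runs (for_loop 6 (NAdd (NCell 0 (NConst 1)) (NCell 0 (NConst 2))) P) s0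
    (size_bound * (trial_time + 5) + 1) (Inv (length es))"
  proof (rule runs_for_loop[where lo = 0 and N = size_bound and T = "trial_time + 3"])
    show "Inv 0 s0"
      using enc by (simp add: Inv_def same_except_def encodes_def Let_def)
    show "length es - 0 \<le> size_bound" using size_bound_ge by simp
    show "nmem s 6 0 = k \<and> nval (NAdd (NCell 0 (NConst 1)) (NCell 0 (NConst 2))) s = length es"
      if "Inv k s" for k s
      using that sizes by (simp add: Inv_def same_except_def)
  next
    fix k s assume inv: "Inv k s"
    have k: "nmem s 6 0 = k" "rmem s = rmem s0" using inv by (simp_all add: Inv_def same_except_def)
    show "runs P s (trial_time + 3) (\<lambda>s'. Inv (Suc k) (nstore 6 0 (Suc (nmem s' 6 0)) s'))"
      unfolding P_def
    proof (rule runs_Seq, rule runs_weaken[OF runs_trial[OF input[OF inv] refl] order_refl])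
      fix s1 assume "same_except {3,4,5,7,8,9,10} s s1 \<and>
        spanning_forest I (decode ls s1) (cheap I (rmem s0 0 (nmem s 6 0))) \<and>
        (nmem s1 10 0 = 0 \<longleftrightarrow> threshold I (rmem s0 0 (nmem s 6 0)))"
      then have s1: "same_except {3,4,5,7,8,9,10} s s1" "nmem s1 10 0 = 0 \<longleftrightarrow> threshold I (c k)"
        by (simp_all add: k c_def)
      have eq: "nmem s1 6 0 = k" "nmem s1 11 = nmem s 11" "nmem s1 12 = nmem s 12" "rmem s1 0 = c"
        using s1(1) k by (simp_all add: same_except_def c_def)
      have same: "same_except {3,4,5,6,7,8,9,10,11,12} s0 s1"
        using s1(1) inv by (simp add: same_except_def Inv_def)
      have same_store: "same_except {3,4,5,6,7,8,9,10,11,12} s0 (nstore a i x s')"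
        if "same_except {3,4,5,6,7,8,9,10,11,12} s0 s'" "a \<in> {6,11,12}" for a i x s'
        using that by (auto simp: same_except_def)
      show "runs (Cond (BAnd (NLess (var 10) (NConst 1))
          (BNot (BAnd (NLess (NConst 0) (var 12)) (BNot (costlier 11 6)))))
          (Seq (assign 11 (var 6)) (assign 12 (NConst 1))) Skip) s1 3
        (\<lambda>s'. Inv (Suc k) (nstore 6 0 (Suc (nmem s' 6 0)) s'))"
        using inv s1(2) same by (auto simp: Inv_def less_Suc_eq eq same_store)
    qed
  qed (simp_all add: algebra_simps)
  moreover have "runs (Seq (assign 6 (var 11)) trial) s (trial_time + 1) ?Q" if "Inv (length es) s" for s
  proof -
    define b where "b = nmem s 11 0"
    have b: "threshold I (c b) \<and> 0 \<le> c b \<and> (edges I = {} \<longrightarrow> c b = 0) \<and>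
      (\<forall>e\<in>edges I. threshold I (ccost I e) \<longrightarrow> c b \<le> ccost I e)"
    proof (cases "edges I = {}")
      case True
      then have "es = []" using enumerations(5) by simp
      \<comment> \<open>Cost cells outside the range of edges are zero, so without edges the final
        trial uses threshold 0 whatever cell array 11 names.\<close>
      then have "c b = 0" using enc by (simp add: c_def encodes_def Let_def)
      then show ?thesis using True threshold_if_no_edges by simp
    next
      case False
      have index: "\<exists>j<length es. c j = ccost I e" if "e \<in> edges I" for e
        using that edge_input(4) unfolding enumerations(5)[symmetric] c_def by (metis in_set_conv_nth)
      obtain e where "e \<in> edges I" "threshold I (ccost I e)"
        using ex_threshold[OF inst False] by blast
      \<comment> \<open>Some edge cost is a threshold, so the case of the invariant in which nothing
        was found is impossible.\<close>
      then have *: "b < length es" "threshold I (c b)"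
        "\<And>j. j < length es \<Longrightarrow> threshold I (c j) \<Longrightarrow> c b \<le> c j"
        using index[of e] that by (auto simp: Inv_def b_def)
      have "0 \<le> c b"
        using inst edge_input(4,5)[OF *(1)] by (auto simp: c_def bmst_instance_def)
      moreover have "c b \<le> ccost I e" if "e \<in> edges I" "threshold I (ccost I e)" for e
        using index[OF that(1)] that(2) *(3) by metis
      ultimately show ?thesis using *(2) False by blast
    qed
    have "input (nstore 6 0 b s)" using input[OF that] by (simp add: input_def)
    then have "runs trial (nstore 6 0 b s) trial_time ?Q"
      by (rule runs_weaken[OF runs_trial[OF _ refl]])
        (use b in \<open>auto simp: c_def intro!: exI[of _ "c b"]\<close>)
    then show ?thesis by (simp add: b_def)
  qed
  ultimately have "runs algorithm s0 (size_bound * (trial_time + 5) + 1 + (trial_time + 1)) ?Q"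
    unfolding algorithm_def P_def[symmetric] by (intro runs_Seq) (auto elim: runs_weaken)
  then show ?thesis by (simp add: total_time_def)
qed

text \<open>The output, being feasible, itself shows that \<open>OPT\<close> is a minimum over a
  nonempty set, which the comparison of \<open>B\<close> with \<open>OPT\<close> requires.\<close>

lemma algorithm_correct:
  "runs algorithm s0 total_time (\<lambda>s'. feasible I (decode ls s') \<and>
     leader_cost I (decode ls s') \<le> (real (card (verts I)) - 1) * OPT I)"
proof (rule runs_weaken[OF runs_algorithm order_refl])
  fix s'
  assume "\<exists>B. 0 \<le> B \<and> threshold I B \<and> spanning_forest I (decode ls s') (cheap I B) \<and>
    (edges I = {} \<longrightarrow> B = 0) \<and> (\<forall>e\<in>edges I. threshold I (ccost I e) \<longrightarrow> B \<le> ccost I e)"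
  then obtain B where B: "0 \<le> B" "threshold I B" "spanning_forest I (decode ls s') (cheap I B)"
    "edges I = {} \<longrightarrow> B = 0" "\<forall>e\<in>edges I. threshold I (ccost I e) \<longrightarrow> B \<le> ccost I e" by blast
  have f: "feasible I (decode ls s')" using threshold_feasible(1)[OF inst B(3,2)] .
  have "B \<le> OPT I"
  proof (cases "edges I = {}")
    case True
    then show ?thesis using B(4) OPT_nonneg[OF inst f] by simp
  next
    case False
    then show ?thesis using OPT_threshold[OF inst f] B(5) by fastforce
  qed
  have "0 < card (verts I)" using inst by (simp add: bmst_instance_def card_gt_0_iff)
  have "leader_cost I (decode ls s') \<le> (real (card (verts I)) - 1) * B"
    using threshold_cost[OF inst B(3,2,1)] .
  also have "\<dots> \<le> (real (card (verts I)) - 1) * OPT I"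
    using \<open>B \<le> OPT I\<close> \<open>0 < card (verts I)\<close> by (intro mult_left_mono) auto
  finally show "feasible I (decode ls s') \<and>
    leader_cost I (decode ls s') \<le> (real (card (verts I)) - 1) * OPT I"
    using f by blast
qed

end

theorem theorem8:
  "\<exists>P. polytime_algorithm
     (\<lambda>I X. feasible I X \<and> leader_cost I X \<le> (real (card (verts I)) - 1) * OPT I) P"
proof
  \<comment> \<open>The time bounds are rebuilt with the indeterminate in place of
    \<open>size_bound\<close>; they consist of sums and products only, so they are polynomials over
    \<open>nat\<close>.\<close>
  define x :: "nat poly" where "x = [:0, 1:]"
  define t where "t = 8 * x * x + 25 * x + 8"
  define p where "p = x * (t + 5) + t + 2"
  show "polytime_algorithm
     (\<lambda>I X. feasible I X \<and> leader_cost I X \<le> (real (card (verts I)) - 1) * OPT I) algorithm"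
    unfolding polytime_algorithm_def
  proof (intro exI[of _ p] allI impI)
    fix I :: "(nat, nat) bmst" and vs ls s
    assume "bmst_instance I" "encodes I vs ls s"
    then interpret encoded I vs ls s by unfold_locales
    have "poly p (card (verts I) + card (edges I)) = total_time"
      by (simp add: p_def t_def x_def total_time_def trial_time_def size_bound_def algebra_simps)
    then show "\<exists>t s'. exec algorithm s t s' \<and> t \<le> poly p (card (verts I) + card (edges I)) \<and>
        (feasible I (decode ls s') \<and>
         leader_cost I (decode ls s') \<le> (real (card (verts I)) - 1) * OPT I)"
      using algorithm_correct by (simp add: runs_def)
  qed
qed

end
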